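(* Suppose that a partially ordered set $P$, of cardinality $s\ge 2$, is a cartesian product of chains $P_1,P_2,\ldots,P_t$, where each $P_i$ has cardinality $k_i$. Let $K:=\sum_{i=1}^t (k_i-1)$. Then $$w(P)\le \left\lfloor \frac{s}{2^K}\binom{K}{\lfloor K/2\rfloor}\right\rfloor\le \left\lfloor \frac{bs}{\sqrt K}\right\rfloor\le \left\lfloor\frac{bs}{\sqrt{\log s}}\right\rfloor,$$ where $b=\sqrt{2/\pi}$. Furthermore, if each chain has the same cardinality $p$, then $w(P)\le \left\lfloor \frac{bp^t}{\sqrt{t(p-1)}}\right\rfloor$.
   Context: For a finite partially ordered set $P$, the width $w(P)$ is the maximum cardinality of an antichain in $P$. The cartesian product of chains carries the componentwise partial order. $\log$ means logarithm to base $2$. *)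

theory Defs
  imports Complex_Main "HOL-Library.FuncSet"
begin

definition antichain_on :: "'a set \<Rightarrow> 'a rel \<Rightarrow> 'a set \<Rightarrow> bool" where
  "antichain_on P r S \<longleftrightarrow>
     S \<subseteq> P \<and> (\<forall>x\<in>S. \<forall>y\<in>S. x \<noteq> y \<longrightarrow> (x, y) \<notin> r \<and> (y, x) \<notin> r)"

(* Meaningful for finite P only: Max of an infinite set is unspecified. *)
definition width :: "'a set \<Rightarrow> 'a rel \<Rightarrow> nat" where
  "width P r = Max {card S | S. antichain_on P r S}"

definition product_order :: "'i set \<Rightarrow> ('i \<Rightarrow> 'a set) \<Rightarrow> ('i \<Rightarrow> 'a rel) \<Rightarrow> ('i \<Rightarrow> 'a) rel" where
  "product_order I C r =
     {(f, g). f \<in> Pi\<^sub>E I C \<and> g \<in> Pi\<^sub>E I C \<and> (\<forall>i\<in>I. (f i, g i) \<in> r i)}"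

lemma partial_order_on_product_order:
  assumes "\<And>i. i \<in> I \<Longrightarrow> partial_order_on (C i) (r i)"
  shows "partial_order_on (Pi\<^sub>E I C) (product_order I C r)"
proof -
  have refl: "\<And>i x. i \<in> I \<Longrightarrow> x \<in> C i \<Longrightarrow> (x, x) \<in> r i"
    and tr: "\<And>i. i \<in> I \<Longrightarrow> trans (r i)" and anti: "\<And>i. i \<in> I \<Longrightarrow> antisym (r i)"
    using assms by (auto simp: order_on_defs refl_on_def)
  have "refl_on (Pi\<^sub>E I C) (product_order I C r)"
    using refl by (auto simp: refl_on_def product_order_def PiE_mem)
  moreover have "trans (product_order I C r)"
  proof (rule transI)
    fix f g h
    assume fgh: "(f, g) \<in> product_order I C r" "(g, h) \<in> product_order I C r"
    then have "(f i, h i) \<in> r i" if "i \<in> I" for i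
      using transD[OF tr[OF that]] that by (simp add: product_order_def) blast
    then show "(f, h) \<in> product_order I C r"
      using fgh by (simp add: product_order_def)
  qed
  moreover have "antisym (product_order I C r)"
  proof (rule antisymI)
    fix f g
    assume fg: "(f, g) \<in> product_order I C r" "(g, f) \<in> product_order I C r"
    then have "f i = g i" if "i \<in> I" for i
      using antisymD[OF anti[OF that]] that by (simp add: product_order_def)
    then show "f = g"
      using fg by (intro PiE_ext[of f I C g]) (simp_all add: product_order_def)
  qed
  ultimately show ?thesis
    by (auto simp: order_on_defs product_order_def)
qed

end

theory Submission
  imports Defs "HOL-Analysis.Gamma_Function" "HOL-Real_Asymp.Real_Asymp"
begin

text \<open>
  A product of two chains with \<open>k\<close> and \<open>m\<close> elements splits into \<open>min k m\<close> chains with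
  \<open>k + m - 1 - 2 i\<close> elements, \<open>i < min k m\<close>. Applied to the first two factors of a product, this
  bounds antichains recursively. Extending all functions of the chain size to odd functions on
  the integers turns the recursion into commuting operators \<open>(T\<^sub>m f)(k) = \<Sum>\<^sub>i f(k + m - 1 - 2 i)\<close>
  with \<open>i < m\<close>, so that antichains have at most \<open>(T\<^bsub>k(1)\<^esub> \<dots> T\<^bsub>k(t)\<^esub> sgn)(1)\<close> elements.
  The operators preserve concavity (with step 2) on the nonnegative integers. Together with
  \<open>T\<^sub>m T\<^sub>2 = T\<^bsub>m+1\<^esub> + T\<^bsub>m-1\<^esub>\<close> at 1, concavity shows that replacing a chain of size \<open>m\<close> by \<open>m - 1\<close>
  chains of size 2 does not decrease the ratio of the bound to the number of elements. This
  reduces everything to the Boolean lattice, where \<open>(T\<^sub>2\<^sup>K sgn)(1) = binom(K, \<lfloor>K/2\<rfloor>)\<close>, and the estimate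
  of the middle binomial coefficient comes from Wallis' product.
\<close>

section \<open>The operators \<open>conv\<close> on odd functions\<close>

definition conv :: "nat \<Rightarrow> (int \<Rightarrow> int) \<Rightarrow> int \<Rightarrow> int" where
  "conv m f k = (\<Sum>i<m. f (k + int m - 1 - 2 * int i))"

definition odd_fun :: "(int \<Rightarrow> int) \<Rightarrow> bool" where
  "odd_fun f \<longleftrightarrow> (\<forall>k. f (- k) = - f k)"

lemma odd_fun_0: "odd_fun f \<Longrightarrow> f 0 = 0"
  unfolding odd_fun_def by (metis add.inverse_neutral eq_neg_iff_add_eq_0 mult_2 mult_eq_0_iff zero_neq_numeral)

lemma sum_eq_0_antisymmetric:
  fixes g :: "nat \<Rightarrow> int"
  assumes "\<And>i. i < n \<Longrightarrow> g (n - Suc i) = - g i"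
  shows "(\<Sum>i<n. g i) = 0"
proof -
  have "(\<Sum>i<n. g i) = (\<Sum>i<n. g (n - Suc i))"
    by (rule sum.nat_diff_reindex[symmetric])
  also have "\<dots> = - (\<Sum>i<n. g i)"
    using assms by (simp add: sum_negf)
  finally show ?thesis by simp
qed

lemma odd_fun_conv:
  assumes "odd_fun f"
  shows "odd_fun (conv m f)"
  unfolding odd_fun_def
proof
  fix k
  have "conv m f (- k) = (\<Sum>i<m. f (- k + int m - 1 - 2 * int (m - Suc i)))"
    unfolding conv_def by (rule sum.nat_diff_reindex[symmetric])
  also have "\<dots> = (\<Sum>i<m. - f (k + int m - 1 - 2 * int i))"
  proof (rule sum.cong[OF refl])
    fix i assume "i \<in> {..<m}"
    then have "- k + int m - 1 - 2 * int (m - Suc i) = - (k + int m - 1 - 2 * int i)"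
      by (simp add: of_nat_diff)
    then show "f (- k + int m - 1 - 2 * int (m - Suc i)) = - f (k + int m - 1 - 2 * int i)"
      using assms by (simp only: odd_fun_def)
  qed
  also have "\<dots> = - conv m f k"
    by (simp add: conv_def sum_negf)
  finally show "conv m f (- k) = - conv m f k" .
qed

lemma conv_commute: "conv m (conv n f) = conv n (conv m f)"
proof
  fix k
  have "conv m (conv n f) k = (\<Sum>j<n. \<Sum>i<m. f (k + int m - 1 - 2 * int i + int n - 1 - 2 * int j))"
    unfolding conv_def by (rule sum.swap)
  then show "conv m (conv n f) k = conv n (conv m f) k"
    by (simp add: conv_def algebra_simps)
qed

lemma conv_2: "conv 2 f k = f (k + 1) + f (k - 1)"
  by (simp add: conv_def numeral_2_eq_2 add.commute)

text \<open>If m > k, the terms with i >= k have arguments running symmetrically from m - k - 1 down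
  to k + 1 - m, so they cancel by oddness. This trades the sum over min k m chains for one over m
  terms, a form in which the operators visibly commute.\<close>

lemma conv_truncate:
  assumes "odd_fun f"
  shows "conv m f (int k) = (\<Sum>i<min k m. f (int k + int m - 1 - 2 * int i))"
proof (cases "k < m")
  case False
  then show ?thesis by (simp add: conv_def min_def)
next
  case True
  let ?g = "\<lambda>i. f (int k + int m - 1 - 2 * int i)"
  have split: "(\<Sum>i<k + d. ?g i) = (\<Sum>i<k. ?g i) + (\<Sum>i<d. ?g (k + i))" for d
    by (induction d) simp_all
  have "(\<Sum>i<m. ?g i) = (\<Sum>i<k + (m - k). ?g i)"
    using True by simp
  also have "\<dots> = (\<Sum>i<k. ?g i) + (\<Sum>i<m - k. ?g (k + i))"
    by (rule split)
  also have "(\<Sum>i<m - k. ?g (k + i)) = 0"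
  proof (rule sum_eq_0_antisymmetric)
    fix i assume "i < m - k"
    then have "int k + int m - 1 - 2 * int (k + (m - k - Suc i))
        = - (int k + int m - 1 - 2 * int (k + i))"
      by (simp add: of_nat_diff)
    then show "?g (k + (m - k - Suc i)) = - ?g (k + i)"
      using assms by (simp only: odd_fun_def)
  qed
  finally show ?thesis
    using True by (simp add: conv_def min_def)
qed

lemma conv_at_1:
  assumes "odd_fun f"
  shows "conv m f 1 = f (int m)"
  using conv_truncate[OF assms, of m 1] odd_fun_0[OF assms] by (cases m) auto

section \<open>Concavity on the nonnegative integers\<close>

text \<open>Step 2 matches the shifts in \<open>conv\<close>, which never mix parities. For odd f
  the condition is void at k = 0, and at k = 1 it reads f 3 <= 3 * f 1.\<close>

definition concave_odd :: "(int \<Rightarrow> int) \<Rightarrow> bool" where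
  "concave_odd f \<longleftrightarrow> odd_fun f \<and> (\<forall>k\<ge>0. f (k + 2) + f (k - 2) \<le> 2 * f k)"

lemma concave_odd_sgn: "concave_odd sgn"
  by (auto simp: concave_odd_def odd_fun_def sgn_if)

text \<open>The negated second difference \<open>g\<close> is again odd, it is nonnegative on the
  nonnegative integers, and taking it commutes with \<open>conv m\<close>. By
  \<open>conv_truncate\<close>, \<open>conv m g k\<close> sums values of \<open>g\<close> at
  positive arguments only.\<close>

lemma concave_odd_conv:
  assumes "concave_odd f"
  shows "concave_odd (conv m f)"
  unfolding concave_odd_def
proof (intro conjI allI impI)
  have f: "odd_fun f" using assms by (simp add: concave_odd_def)
  show "odd_fun (conv m f)" using f by (rule odd_fun_conv)
  fix k :: int assume "0 \<le> k"
  then obtain n where n: "k = int n" by (rule nonneg_int_cases)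
  define g where "g = (\<lambda>k. 2 * f k - f (k + 2) - f (k - 2))"
  have g_nonneg: "0 \<le> g j" if "0 \<le> j" for j
    using assms that by (simp add: g_def concave_odd_def algebra_simps)
  have g: "odd_fun g"
    unfolding odd_fun_def
  proof
    fix j
    have "f (- j + 2) = - f (j - 2)" "f (- j - 2) = - f (j + 2)" "f (- j) = - f j"
      using f unfolding odd_fun_def by (metis minus_diff_eq uminus_add_conv_diff add.commute minus_add_distrib diff_conv_add_uminus)+
    then show "g (- j) = - g j" by (simp add: g_def)
  qed
  have "conv m g k = 2 * conv m f k - conv m f (k + 2) - conv m f (k - 2)"
    by (simp add: conv_def g_def sum_subtractf sum.distrib sum_distrib_left algebra_simps)
  moreover have "0 \<le> conv m g k"
    unfolding n conv_truncate[OF g] by (intro sum_nonneg g_nonneg) auto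
  ultimately show "conv m f (k + 2) + conv m f (k - 2) \<le> 2 * conv m f k" by simp
qed

text \<open>Slopes from the origin of a concave function vanishing at 0 decrease. The induction has
  step 2 and adds concavity at j + 2 to the case j; oddness supplies both base cases.\<close>

lemma concave_odd_ratio:
  assumes "concave_odd f"
  shows "int j * f (int j + 2) \<le> (int j + 2) * f (int j)"
proof (induction j rule: induct_nat_012)
  case 0
  have "f 0 = 0" using assms odd_fun_0 by (simp add: concave_odd_def)
  then show ?case by simp
next
  case 1
  have "f (1 + 2) + f (1 - 2) \<le> 2 * f 1" and "f (- 1) = - f 1"
    using assms by (auto simp only: concave_odd_def odd_fun_def zero_le_one)
  then show ?case by simp
next
  case (ge2 j)
  have "f (int j + 2 + 2) + f (int j + 2 - 2) \<le> 2 * f (int j + 2)"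
    using assms unfolding concave_odd_def by (metis add_nonneg_nonneg of_nat_0_le_iff zero_le_numeral)
  then have "(int j + 2) * (f (int j + 4) + f (int j)) \<le> (int j + 2) * (2 * f (int j + 2))"
    by (intro mult_left_mono) (auto simp: add.assoc)
  with ge2.IH(1) show ?case by (simp add: algebra_simps)
qed

lemma concave_odd_funpow: "concave_odd f \<Longrightarrow> concave_odd ((conv m ^^ n) f)"
  by (induction n) (auto intro: concave_odd_conv)

lemma concave_odd_foldr: "concave_odd f \<Longrightarrow> concave_odd (foldr conv ms f)"
  by (induction ms) (auto intro: concave_odd_conv)

lemma foldr_conv_commute: "conv m (foldr conv ms f) = foldr conv ms (conv m f)"
  by (induction ms) (simp_all, metis conv_commute)

lemma foldr_conv_funpow_commute: "(conv m ^^ n) (foldr conv ms f) = foldr conv ms ((conv m ^^ n) f)"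
  by (induction n) (simp_all add: foldr_conv_commute)

section \<open>Comparison with two-element chains\<close>

lemma conv_le_funpow_conv_2:
  assumes "concave_odd f"
  shows "2 ^ m * conv (Suc m) f 1 \<le> int (Suc m) * (conv 2 ^^ m) f 1"
  using assms
proof (induction m arbitrary: f)
  case 0
  then show ?case by (simp add: conv_def)
next
  case (Suc m)
  note f = \<open>concave_odd f\<close>
  have odd: "odd_fun f" "odd_fun (conv 2 f)"
    using f concave_odd_conv[OF f] by (simp_all add: concave_odd_def)
  let ?a = "conv (Suc (Suc m)) f 1"
  \<comment> \<open>By \<open>conv_at_1\<close> and \<open>conv_2\<close> this says 2 * (m + 1) * f
    (m + 2) <= (m + 2) * (f (m + 2) + f m), which is the ratio inequality at j = m.\<close>
  have "2 * int (Suc m) * ?a \<le> int (Suc (Suc m)) * conv (Suc m) (conv 2 f) 1"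
    using concave_odd_ratio[OF f, of m] by (simp add: conv_at_1 odd conv_2 algebra_simps)
  then have "2 ^ m * (2 * int (Suc m) * ?a) \<le> 2 ^ m * (int (Suc (Suc m)) * conv (Suc m) (conv 2 f) 1)"
    by (rule mult_left_mono) simp
  also have "\<dots> = int (Suc (Suc m)) * (2 ^ m * conv (Suc m) (conv 2 f) 1)"
    by (simp only: mult.left_commute)
  also have "\<dots> \<le> int (Suc (Suc m)) * (int (Suc m) * (conv 2 ^^ m) (conv 2 f) 1)"
    by (intro mult_left_mono Suc.IH concave_odd_conv f) simp
  finally have "int (Suc m) * (2 ^ Suc m * ?a)
      \<le> int (Suc m) * (int (Suc (Suc m)) * (conv 2 ^^ Suc m) f 1)"
    by (simp only: funpow_Suc_right o_apply power_Suc mult_ac)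
  then show ?case
    by (rule mult_left_le_imp_le) simp
qed

text \<open>The parameter n counts the two-element chains already produced. Each step breaks up the
  head of the list and moves the resulting powers of \<open>conv 2\<close> inwards by commutation.
  An entry 0 makes both sides vanish.\<close>

lemma foldr_conv_le:
  "foldr conv ks ((conv 2 ^^ n) sgn) 1 * 2 ^ (\<Sum>k\<leftarrow>ks. k - 1)
    \<le> int (prod_list ks) * (conv 2 ^^ (n + (\<Sum>k\<leftarrow>ks. k - 1))) sgn 1"
proof (induction ks arbitrary: n)
  case Nil
  then show ?case by simp
next
  case (Cons k ks)
  show ?case
  proof (cases k)
    case 0
    then show ?thesis by (simp add: conv_def)
  next
    case (Suc m)
    define f where "f = foldr conv ks ((conv 2 ^^ n) sgn)"
    define N where "N = (\<Sum>k\<leftarrow>ks. k - 1)"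
    have f: "concave_odd f"
      unfolding f_def by (intro concave_odd_foldr concave_odd_funpow concave_odd_sgn)
    have comm: "(conv 2 ^^ m) f = foldr conv ks ((conv 2 ^^ (n + m)) sgn)"
      by (simp add: f_def foldr_conv_funpow_commute funpow_add add.commute[of n m])
    have "(2 ^ m * conv (Suc m) f 1) * 2 ^ N \<le> (int (Suc m) * (conv 2 ^^ m) f 1) * 2 ^ N"
      by (intro mult_right_mono conv_le_funpow_conv_2 f) simp
    also have "\<dots> = int (Suc m) * (foldr conv ks ((conv 2 ^^ (n + m)) sgn) 1 * 2 ^ N)"
      by (simp add: comm)
    also have "\<dots> \<le> int (Suc m) * (int (prod_list ks) * (conv 2 ^^ (n + m + N)) sgn 1)"
      unfolding N_def by (intro mult_left_mono Cons.IH) simp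
    finally show ?thesis
      by (simp add: Suc f_def N_def power_add algebra_simps)
  qed
qed

text \<open>This is the binomial theorem for \<open>conv 2\<close>, a sum of two mutually inverse
  shifts.\<close>

lemma funpow_conv_2: "(conv 2 ^^ n) f k = (\<Sum>j\<le>n. int (n choose j) * f (k + int n - 2 * int j))"
proof (induction n arbitrary: k)
  case 0
  then show ?case by simp
next
  case (Suc n)
  let ?g = "\<lambda>j. f (k + 1 + int n - 2 * int j)"
  have "(conv 2 ^^ Suc n) f k = (\<Sum>j\<le>n. int (n choose j) * ?g j) + (\<Sum>j\<le>n. int (n choose j) * ?g (Suc j))"
    by (simp add: conv_2 Suc.IH algebra_simps)
  also have "(\<Sum>j\<le>n. int (n choose j) * ?g j) = (\<Sum>j\<le>Suc n. int (n choose j) * ?g j)"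
    by simp
  also have "\<dots> = ?g 0 + (\<Sum>j\<le>n. int (n choose Suc j) * ?g (Suc j))"
    by (subst sum.atMost_Suc_shift) simp
  also have "\<dots> + (\<Sum>j\<le>n. int (n choose j) * ?g (Suc j))
      = ?g 0 + (\<Sum>j\<le>n. int (Suc n choose Suc j) * ?g (Suc j))"
    by (simp add: sum.distrib[symmetric] algebra_simps)
  also have "\<dots> = (\<Sum>j\<le>Suc n. int (Suc n choose j) * ?g j)"
    by (subst sum.atMost_Suc_shift) simp
  finally show ?case by (simp add: algebra_simps)
qed

text \<open>The reflection j -> n - j cancels the negative terms against the positive ones with 2 *
  j + 1 < n. Only n - 1 <= 2 * j <= n survives, that is, j = n div 2.\<close>

lemma funpow_conv_2_sgn: "(conv 2 ^^ n) sgn 1 = int (n choose (n div 2))"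
proof -
  let ?c = "\<lambda>j. int (n choose j)"
  have "(conv 2 ^^ n) sgn 1 = (\<Sum>j\<le>n. ?c j * sgn (1 + int n - 2 * int j))"
    by (rule funpow_conv_2)
  also have "\<dots> = (\<Sum>j\<le>n. ?c j * of_bool (2 * j < n + 1)) - (\<Sum>j\<le>n. ?c j * of_bool (n + 1 < 2 * j))"
    unfolding sum_subtractf[symmetric] by (intro sum.cong refl) (auto simp: sgn_if)
  also have "(\<Sum>j\<le>n. ?c j * of_bool (n + 1 < 2 * j)) = (\<Sum>j\<le>n. ?c (n - j) * of_bool (n + 1 < 2 * (n - j)))"
    by (rule sum.reindex_bij_witness[of _ "\<lambda>j. n - j" "\<lambda>j. n - j"]) auto
  also have "\<dots> = (\<Sum>j\<le>n. ?c j * of_bool (2 * j + 1 < n))"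
    by (intro sum.cong refl) (auto simp: binomial_symmetric[symmetric])
  also have "(\<Sum>j\<le>n. ?c j * of_bool (2 * j < n + 1)) - \<dots> = (\<Sum>j\<le>n. if j = n div 2 then ?c j else 0)"
    unfolding sum_subtractf[symmetric] by (intro sum.cong refl) auto
  also have "\<dots> = ?c (n div 2)" by simp
  finally show ?thesis .
qed

section \<open>Antichains in boxes of natural numbers\<close>

text \<open>Reflecting the order is enough: elements of an antichain with comparable images are
  comparable, hence equal. Injectivity follows because equal images are comparable by
  reflexivity.\<close>

lemma antichain_on_image:
  assumes "antichain_on P r S"
    and q: "refl_on Q q" "f ` S \<subseteq> Q"
    and reflects: "\<And>x y. x \<in> S \<Longrightarrow> y \<in> S \<Longrightarrow> (f x, f y) \<in> q \<Longrightarrow> (x, y) \<in> r"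
  shows "antichain_on Q q (f ` S)" and "inj_on f S"
proof -
  have anti: "x = y" if "x \<in> S" "y \<in> S" "(f x, f y) \<in> q" for x y
    using assms(1) reflects[OF that] that by (auto simp: antichain_on_def)
  show "antichain_on Q q (f ` S)"
    using q(2) anti by (auto simp: antichain_on_def)
  show "inj_on f S"
  proof (rule inj_onI)
    fix x y assume "x \<in> S" "y \<in> S" "f x = f y"
    moreover have "(f y, f y) \<in> q"
      using q \<open>y \<in> S\<close> by (auto simp: refl_on_def)
    ultimately show "x = y" using anti by simp
  qed
qed

definition box :: "nat list \<Rightarrow> nat list set" where
  "box ks = {xs. list_all2 (<) xs ks}"

definition leq_lists :: "(nat list) rel" where
  "leq_lists = {(xs, ys). list_all2 (\<le>) xs ys}"

lemma refl_leq_lists: "refl leq_lists"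
  by (auto simp: refl_on_def leq_lists_def intro: list_all2_refl)

lemma box_Cons_iff: "xs \<in> box (k # ks) \<longleftrightarrow> (\<exists>x ys. xs = x # ys \<and> x < k \<and> ys \<in> box ks)"
  by (simp add: box_def list_all2_Cons2)

lemma box_Nil: "box [] = {[]}"
  by (simp add: box_def)

lemma finite_box: "finite (box ks)"
proof (induction ks)
  case Nil
  then show ?case by (simp add: box_Nil)
next
  case (Cons k ks)
  have "box (k # ks) = (\<lambda>(x, xs). x # xs) ` ({..<k} \<times> box ks)"
    by (auto simp: box_Cons_iff)
  then show ?case using Cons.IH by simp
qed

text \<open>The head k is arbitrary in the induction because merging the two leading chains changes
  it. In the base case an antichain of a single chain has at most one element, and none if k = 0,
  which is the value of \<open>sgn\<close>.\<close>

lemma card_antichain_box_le: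
  assumes "antichain_on (box (k # ks)) leq_lists S"
  shows "int (card S) \<le> foldr conv ks sgn (int k)"
  using assms
proof (induction ks arbitrary: k S)
  case Nil
  have S: "\<exists>a<k. x = [a]" if "x \<in> S" for x
    using Nil that unfolding antichain_on_def by (fastforce simp: box_Cons_iff box_Nil)
  have "x = y" if "x \<in> S" "y \<in> S" for x y
  proof -
    obtain a b where ab: "x = [a]" "y = [b]"
      using S[OF \<open>x \<in> S\<close>] S[OF \<open>y \<in> S\<close>] by blast
    then have "(x, y) \<in> leq_lists \<or> (y, x) \<in> leq_lists"
      by (auto simp: leq_lists_def)
    then show ?thesis
      using Nil that unfolding antichain_on_def by blast
  qed
  moreover have "S = {}" if "k = 0"
    using S that by auto
  moreover have "finite S"
    using Nil finite_box finite_subset unfolding antichain_on_def by blast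
  ultimately show ?case
    by (cases "k = 0") (auto simp: card_le_Suc0_iff_eq)
next
  case (Cons m ks)
  \<comment> \<open>The chain with index \<open>i\<close> climbs from \<open>(i, 0)\<close> to \<open>(i, m - 1 - i)\<close> and on to \<open>(k - 1, m - 1 - i)\<close>;
    \<open>g\<close> is the index of the chain through the first two entries, and \<open>\<phi> i\<close> replaces these
    by their position on the chain.\<close>
  define g where "g = (\<lambda>xs :: nat list. min (hd xs) (m - 1 - hd (tl xs)))"
  define \<phi> where "\<phi> = (\<lambda>i (xs :: nat list). (hd xs + hd (tl xs) - i) # tl (tl xs))"
  have fin: "finite S"
    using Cons.prems finite_box finite_subset unfolding antichain_on_def by blast
  have S: "\<exists>x y zs. xs = x # y # zs \<and> x < k \<and> y < m \<and> zs \<in> box ks" if "xs \<in> S" for xs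
    using Cons.prems that unfolding antichain_on_def by (blast dest: box_Cons_iff[THEN iffD1])
  have "card {xs \<in> S. g xs = i} \<le> foldr conv ks sgn (int k + int m - 1 - 2 * int i)"
    if i: "i < min k m" for i
  proof -
    let ?S = "{xs \<in> S. g xs = i}"
    have "antichain_on (box (k # m # ks)) leq_lists ?S"
      using Cons.prems by (auto simp: antichain_on_def)
    \<comment> \<open>Positions on chain i run from 0 to (k - 1) + (m - 1 - i) - i, which gives its
      size.\<close>
    moreover have "\<phi> i ` ?S \<subseteq> box ((k + m - 1 - 2 * i) # ks)"
      using i by (auto dest!: S simp: \<phi>_def g_def box_Cons_iff min_def split: if_splits)
    \<comment> \<open>Along one chain both leading entries are monotone in the position, so
      comparing positions compares the entries.\<close>
    moreover have "(xs, ys) \<in> leq_lists"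
      if "xs \<in> ?S" "ys \<in> ?S" "(\<phi> i xs, \<phi> i ys) \<in> leq_lists" for xs ys
      using that by (auto dest!: S simp: \<phi>_def g_def leq_lists_def min_def split: if_splits)
    ultimately have "antichain_on UNIV leq_lists (\<phi> i ` ?S)" "inj_on (\<phi> i) ?S"
      using antichain_on_image[OF _ refl_leq_lists, of _ leq_lists ?S "\<phi> i"] by auto
    then have "antichain_on (box ((k + m - 1 - 2 * i) # ks)) leq_lists (\<phi> i ` ?S)"
      using \<open>\<phi> i ` ?S \<subseteq> _\<close> by (simp add: antichain_on_def)
    then have "int (card (\<phi> i ` ?S)) \<le> foldr conv ks sgn (int (k + m - 1 - 2 * i))"
      by (rule Cons.IH)
    moreover have "int (k + m - 1 - 2 * i) = int k + int m - 1 - 2 * int i"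
      using i by linarith
    ultimately show ?thesis
      using card_image[OF \<open>inj_on (\<phi> i) ?S\<close>] by (simp only:)
  qed
  then have "(\<Sum>i<min k m. int (card {xs \<in> S. g xs = i})) \<le> conv m (foldr conv ks sgn) (int k)"
    using concave_odd_foldr[OF concave_odd_sgn, of ks]
    by (auto simp: conv_truncate concave_odd_def intro!: sum_mono)
  moreover have "g ` S \<subseteq> {..<min k m}"
    by (auto dest!: S simp: g_def)
  then have "card S = (\<Sum>i<min k m. card {xs \<in> S. g xs = i})"
    using sum.group[OF fin finite_lessThan, of g "min k m" "\<lambda>_. 1 :: nat"] by simp
  ultimately show ?case by simp
qed

section \<open>Passage to arbitrary finite chains\<close>

definition rank_in :: "'a set \<Rightarrow> 'a rel \<Rightarrow> 'a \<Rightarrow> nat" where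
  "rank_in A r x = card {y \<in> A. (y, x) \<in> r \<and> y \<noteq> x}"

lemma rank_in_less_card: "finite A \<Longrightarrow> x \<in> A \<Longrightarrow> rank_in A r x < card A"
  unfolding rank_in_def by (intro psubset_card_mono) auto

text \<open>Otherwise y lies strictly below x. Then every strict predecessor of y is one of x, and y
  itself is a further one, so the rank of y is strictly smaller.\<close>

lemma rank_in_reflects:
  assumes "linear_order_on A r" "finite A" "x \<in> A" "y \<in> A" "rank_in A r x \<le> rank_in A r y"
  shows "(x, y) \<in> r"
proof (rule ccontr)
  assume xy: "(x, y) \<notin> r"
  have r: "trans r" "antisym r" "refl_on A r" "total_on A r"
    using assms(1) by (auto simp: order_on_defs)
  have yx: "(y, x) \<in> r" "x \<noteq> y"
    using r(3,4) xy assms(3,4) unfolding total_on_def refl_on_def by metis+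
  have "{z \<in> A. (z, y) \<in> r \<and> z \<noteq> y} \<subseteq> {z \<in> A. (z, x) \<in> r \<and> z \<noteq> x}"
    using transD[OF r(1) _ yx(1)] antisymD[OF r(2)] yx xy by blast
  moreover have "y \<in> {z \<in> A. (z, x) \<in> r \<and> z \<noteq> x}"
    using yx assms(4) by simp
  ultimately have "{z \<in> A. (z, y) \<in> r \<and> z \<noteq> y} \<subset> {z \<in> A. (z, x) \<in> r \<and> z \<noteq> x}"
    by blast
  then have "rank_in A r y < rank_in A r x"
    unfolding rank_in_def using assms(2) by (intro psubset_card_mono) auto
  with assms(5) show False by simp
qed

lemma width_le:
  assumes "finite P" and le: "\<And>S. antichain_on P r S \<Longrightarrow> card S \<le> n"
  shows "width P r \<le> n"
proof -
  have "{card S |S. antichain_on P r S} \<subseteq> card ` Pow P"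
    by (auto simp: antichain_on_def)
  then have "finite {card S |S. antichain_on P r S}"
    using assms(1) finite_subset by blast
  moreover have "antichain_on P r {}"
    by (simp add: antichain_on_def)
  ultimately show ?thesis
    unfolding width_def using le by (subst Max_le_iff) auto
qed

lemma card_antichain_product_order_le:
  fixes C :: "nat \<Rightarrow> 'a set"
  assumes chains: "\<And>i. i \<in> {1..t} \<Longrightarrow> finite (C i) \<and> linear_order_on (C i) (r i)"
    and S: "antichain_on (Pi\<^sub>E {1..t} C) (product_order {1..t} C r) S"
  shows "int (card S) \<le> foldr conv (map (\<lambda>i. card (C i)) [1..<Suc t]) sgn 1"
proof -
  let ?is = "[1..<Suc t]"
  \<comment> \<open>The leading 0 lives in a dummy one-element chain. It provides the head that the
    box bound asks for, also when t = 0, and makes the bound a value at 1.\<close>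
  define \<phi> where "\<phi> = (\<lambda>f. 0 # map (\<lambda>i. rank_in (C i) (r i) (f i)) ?is)"
  let ?B = "box (1 # map (\<lambda>i. card (C i)) ?is)"
  have mem: "f i \<in> C i" if "f \<in> S" "i \<in> {1..t}" for f i
    using S that by (auto simp: antichain_on_def PiE_def Pi_def)
  have "(f, g) \<in> product_order {1..t} C r" if "f \<in> S" "g \<in> S" "(\<phi> f, \<phi> g) \<in> leq_lists" for f g
  proof -
    have "(f i, g i) \<in> r i" if i: "i \<in> {1..t}" for i
    proof -
      have "rank_in (C i) (r i) (f i) \<le> rank_in (C i) (r i) (g i)"
        using \<open>(\<phi> f, \<phi> g) \<in> leq_lists\<close> i
        by (auto simp: leq_lists_def \<phi>_def list.rel_map list_all2_same simp del: upt_Suc)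
      then show ?thesis
        using chains[OF i] mem[OF _ i] that \<open>f \<in> S\<close> \<open>g \<in> S\<close> by (intro rank_in_reflects[of "C i"]) auto
    qed
    then show ?thesis
      using S that by (auto simp: product_order_def antichain_on_def)
  qed
  then have img: "antichain_on UNIV leq_lists (\<phi> ` S)" "inj_on \<phi> S"
    using antichain_on_image[OF S refl_leq_lists, of \<phi>] by auto
  have "\<phi> ` S \<subseteq> ?B"
    using chains mem
    by (auto simp: \<phi>_def box_def list.rel_map list_all2_same rank_in_less_card simp del: upt_Suc)
  then have "antichain_on ?B leq_lists (\<phi> ` S)"
    using img(1) by (simp add: antichain_on_def)
  then have "int (card (\<phi> ` S)) \<le> foldr conv (map (\<lambda>i. card (C i)) ?is) sgn (int 1)"
    by (rule card_antichain_box_le)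
  then show ?thesis
    using card_image[OF img(2)] by (simp del: upt_Suc)
qed

lemma card_antichain_product_order_le_binomial:
  fixes C :: "nat \<Rightarrow> 'a set"
  assumes "\<And>i. i \<in> {1..t} \<Longrightarrow> finite (C i) \<and> linear_order_on (C i) (r i)"
    and "antichain_on (Pi\<^sub>E {1..t} C) (product_order {1..t} C r) S"
    and K: "K = (\<Sum>i=1..t. card (C i) - 1)"
  shows "card S * 2 ^ K \<le> card (Pi\<^sub>E {1..t} C) * (K choose (K div 2))"
proof -
  let ?ks = "map (\<lambda>i. card (C i)) [1..<Suc t]"
  have sum: "(\<Sum>k\<leftarrow>?ks. k - 1) = K"
    by (simp add: K comp_def sum_list_distinct_conv_sum_set atLeastLessThanSuc_atLeastAtMost
        del: upt_Suc)
  have prod: "prod_list ?ks = card (Pi\<^sub>E {1..t} C)"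
    by (simp add: card_PiE prod.distinct_set_conv_list[symmetric] atLeastLessThanSuc_atLeastAtMost
        del: upt_Suc)
  have "int (card S) * 2 ^ K \<le> foldr conv ?ks sgn 1 * 2 ^ K"
    using card_antichain_product_order_le[OF assms(1,2)] by (intro mult_right_mono) auto
  also have "\<dots> \<le> int (card (Pi\<^sub>E {1..t} C)) * int (K choose (K div 2))"
    using foldr_conv_le[of ?ks 0] unfolding sum prod by (simp add: funpow_conv_2_sgn)
  finally have "int (card S * 2 ^ K) \<le> int (card (Pi\<^sub>E {1..t} C) * (K choose (K div 2)))"
    by simp
  then show ?thesis by (simp only: of_nat_le_iff)
qed

section \<open>Central binomial coefficients and Wallis' product\<close>

lemma central_binomial_Suc:
  "real (2 * Suc n choose Suc n) / 4 ^ Suc n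
    = (2 * real n + 1) * (real (2 * n choose n) / 4 ^ n) / (2 * (real n + 1))"
proof -
  have "Suc n * (2 * Suc n choose Suc n) = 2 * (Suc n * (Suc (2 * n) choose n))"
    using Suc_times_binomial_eq[of "Suc (2 * n)" n] by (simp add: algebra_simps del: binomial_Suc_Suc)
  also have "Suc n * (Suc (2 * n) choose n) = Suc (2 * n) * (2 * n choose n)"
    using Suc_times_binomial_eq[of "2 * n" n] binomial_symmetric[of n "Suc (2 * n)"]
    by (simp add: mult.commute del: binomial_Suc_Suc)
  finally have "real (Suc n * (2 * Suc n choose Suc n)) = real (2 * (Suc (2 * n) * (2 * n choose n)))"
    by (rule arg_cong)
  then have "real (2 * Suc n choose Suc n) * (real n + 1) = 2 * ((2 * real n + 1) * real (2 * n choose n))"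
    by (simp add: algebra_simps del: binomial_Suc_Suc)
  then have "real (2 * Suc n choose Suc n) = 2 * ((2 * real n + 1) * real (2 * n choose n)) / (real n + 1)"
    by (simp add: eq_divide_eq del: binomial_Suc_Suc)
  then show ?thesis by (simp del: binomial_Suc_Suc)
qed

text \<open>From n to n + 1 the product gains the factor (2n + 2)^2 / ((2n + 1)(2n + 3)), and the
  other factor gains its reciprocal by \<open>central_binomial_Suc\<close>.\<close>

lemma wallis_prod_eq:
  "(\<Prod>k=1..n. (4*real k^2) / (4*real k^2 - 1)) * ((2 * real n + 1) * (real (2 * n choose n) / 4 ^ n)\<^sup>2) = 1"
proof (induction n)
  case 0
  then show ?case by simp
next
  case (Suc n)
  define c where "c = real (2 * n choose n) / 4 ^ n"
  define c' where "c' = real (2 * Suc n choose Suc n) / 4 ^ Suc n"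
  have c': "c' = (2 * real n + 1) * c / (2 * (real n + 1))"
    unfolding c_def c'_def by (rule central_binomial_Suc)
  have "4 * real (Suc n)^2 - 1 = (2 * real n + 1) * (2 * real n + 3)"
    by (simp add: power2_eq_square algebra_simps)
  then have "(4*real (Suc n)^2) / (4*real (Suc n)^2 - 1) * ((2 * real (Suc n) + 1) * c'\<^sup>2)
      = (2 * real n + 1) * c\<^sup>2"
    unfolding c' by (simp add: divide_simps) (simp add: power2_eq_square algebra_simps)
  moreover have "(\<Prod>k=1..Suc n. (4*real k^2) / (4*real k^2 - 1))
      = (4*real (Suc n)^2) / (4*real (Suc n)^2 - 1) * (\<Prod>k=1..n. (4*real k^2) / (4*real k^2 - 1))"
    by (rule prod.nat_ivl_Suc') simp
  ultimately show ?case
    using Suc.IH unfolding c_def c'_def by (simp only: mult.assoc mult.left_commute[of _ "prod _ _"])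
qed

text \<open>The sequence \<open>n c\<^sub>n\<^sup>2\<close> with \<open>c\<^sub>n = binom(2n, n) / 4\<^sup>n\<close> increases,
  and by Wallis' product its limit is \<open>1 / pi\<close>.\<close>
lemma central_binomial_le: "real n * (real (2 * n choose n) / 4 ^ n)\<^sup>2 \<le> 1 / pi"
proof -
  define c where "c = (\<lambda>n. real (2 * n choose n) / 4 ^ n)"
  define W where "W = (\<lambda>n. \<Prod>k=1..n. (4*real k^2) / (4*real k^2 - 1))"
  have W: "W n * ((2 * real n + 1) * (c n)\<^sup>2) = 1" for n
    unfolding W_def c_def by (rule wallis_prod_eq)
  have mono: "real n * (c n)\<^sup>2 \<le> real (Suc n) * (c (Suc n))\<^sup>2" for n
  proof -
    have c: "c (Suc n) = (2 * real n + 1) * c n / (2 * (real n + 1))"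
      unfolding c_def by (rule central_binomial_Suc)
    have "real (Suc n) * (c (Suc n))\<^sup>2 = (2 * real n + 1)\<^sup>2 / (4 * (real n + 1)) * (c n)\<^sup>2"
      unfolding c by (simp add: divide_simps power2_eq_square) (simp add: algebra_simps)
    \<comment> \<open>Here 4 * n * (n + 1) falls short of (2 * n + 1)^2 by exactly 1.\<close>
    moreover have "real n \<le> (2 * real n + 1)\<^sup>2 / (4 * (real n + 1))"
      by (simp add: pos_le_divide_eq power2_eq_square algebra_simps)
    ultimately show ?thesis by (simp only: mult_right_mono zero_le_power2)
  qed
  have eq: "real n * (c n)\<^sup>2 = real n / (2 * real n + 1) * inverse (W n)" for n
  proof -
    have nz: "2 * real n + 1 \<noteq> 0" by linarith
    have "(2 * real n + 1) * (c n)\<^sup>2 = inverse (W n)"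
      using W[of n] by (simp add: inverse_unique)
    then have "(c n)\<^sup>2 = inverse (W n) / (2 * real n + 1)"
      by (subst nonzero_eq_divide_eq[OF nz]) (simp only: mult.commute)
    then show ?thesis by simp
  qed
  have "(\<lambda>n. real n / (2 * real n + 1)) \<longlonglongrightarrow> 1 / 2"
    by real_asymp
  then have "(\<lambda>n. real n * (c n)\<^sup>2) \<longlonglongrightarrow> 1 / 2 * inverse (pi / 2)"
    unfolding eq W_def by (intro tendsto_mult tendsto_inverse wallis) auto
  then have lim: "(\<lambda>n. real n * (c n)\<^sup>2) \<longlonglongrightarrow> 1 / pi"
    by simp
  have "incseq (\<lambda>n. real n * (c n)\<^sup>2)"
    using mono by (rule incseq_SucI)
  from incseq_le[OF this lim] have "real n * (c n)\<^sup>2 \<le> 1 / pi" .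
  then show ?thesis by (simp add: c_def)
qed

text \<open>With c_n = binom(2n, n) / 4^n, the ratio \<open>x\<close> is c_n for K = 2n and c_(n+1)
  for K = 2n + 1. In the odd case K <= 2(n + 1) absorbs the shift.\<close>

lemma middle_binomial_le:
  assumes "K > 0"
  shows "real (K choose (K div 2)) / 2 ^ K \<le> sqrt (2 / pi) / sqrt (real K)"
proof -
  define x where "x = real (K choose (K div 2)) / 2 ^ K"
  have "real K * x\<^sup>2 \<le> 2 / pi"
  proof (cases "even K")
    case True
    then obtain n where n: "K = 2 * n" by blast
    show ?thesis
      using central_binomial_le[of n] by (simp add: x_def n power_mult)
  next
    case False
    then obtain n where n: "K = 2 * n + 1" using oddE by blast
    have "2 * (2 * n + 1 choose n) = (2 * Suc n choose Suc n)"
      using binomial_symmetric[of n "Suc (2 * n)"] by simp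
    then have "real (2 * Suc n choose Suc n) = 2 * real (2 * n + 1 choose n)"
      by (metis of_nat_mult of_nat_numeral)
    then have x: "x = real (2 * Suc n choose Suc n) / 4 ^ Suc n"
      by (simp add: x_def n power_mult power2_eq_square power_mult_distrib[symmetric] del: binomial_Suc_Suc)
    have "real K * x\<^sup>2 \<le> 2 * (real (Suc n) * x\<^sup>2)"
      by (simp add: n algebra_simps)
    also have "\<dots> \<le> 2 * (1 / pi)"
      unfolding x by (intro mult_left_mono central_binomial_le) simp
    finally show ?thesis by simp
  qed
  then have "sqrt (real K * x\<^sup>2) \<le> sqrt (2 / pi)"
    by (rule real_sqrt_le_mono)
  moreover have "sqrt (real K * x\<^sup>2) = sqrt (real K) * x"
    by (simp add: real_sqrt_mult x_def)
  ultimately show ?thesis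
    using assms unfolding x_def[symmetric] by (simp add: pos_le_divide_eq mult.commute)
qed

section \<open>The chain of inequalities\<close>

theorem theorem1p3:
  fixes t s K :: nat
    and C :: "nat \<Rightarrow> 'a set" and r :: "nat \<Rightarrow> 'a rel" and k :: "nat \<Rightarrow> nat"
    and P :: "(nat \<Rightarrow> 'a) set" and R :: "(nat \<Rightarrow> 'a) rel"
    and b :: real
  assumes chains: "\<And>i. i \<in> {1..t} \<Longrightarrow> finite (C i) \<and> linear_order_on (C i) (r i) \<and> card (C i) = k i"
    and P: "P = Pi\<^sub>E {1..t} C"
    and R: "R = product_order {1..t} C r"
    and s: "card P = s" "s \<ge> 2"
    and K: "K = (\<Sum>i=1..t. (k i - 1))"
    and b: "b = sqrt (2 / pi)"
  shows "int (width P R) \<le> \<lfloor>real s / 2 ^ K * real (K choose (K div 2))\<rfloor>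
       \<and> \<lfloor>real s / 2 ^ K * real (K choose (K div 2))\<rfloor> \<le> \<lfloor>b * real s / sqrt (real K)\<rfloor>
       \<and> \<lfloor>b * real s / sqrt (real K)\<rfloor> \<le> \<lfloor>b * real s / sqrt (log 2 (real s))\<rfloor>
       \<and> (\<forall>p. (\<forall>i\<in>{1..t}. k i = p) \<longrightarrow>
              int (width P R) \<le> \<lfloor>b * real p ^ t / sqrt (real t * (real p - 1))\<rfloor>)"
proof -
  \<comment> \<open>Infinite sets have \<open>card\<close> 0, so s >= 2 forces finiteness.\<close>
  have fin: "finite P"
    using s by (metis card.infinite not_numeral_le_zero)
  have s_prod: "s = (\<Prod>i=1..t. k i)"
    using s(1) chains by (simp add: P card_PiE)
  have k_pos: "0 < k i" if "i \<in> {1..t}" for i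
  proof (rule ccontr)
    assume "\<not> 0 < k i"
    with that have "s = 0" unfolding s_prod by (intro prod_zero) auto
    with s(2) show False by simp
  qed
  have K_card: "K = (\<Sum>i=1..t. card (C i) - 1)"
    using chains by (simp add: K)
  \<comment> \<open>The factorwise bound k <= 2^(k - 1) yields both K > 0 and log s <= K.\<close>
  have "s \<le> (\<Prod>i=1..t. 2 ^ (k i - 1))"
    unfolding s_prod
  proof (rule prod_mono)
    fix i assume "i \<in> {1..t}"
    then have "k i = Suc (k i - 1)" using k_pos by simp
    also have "\<dots> \<le> 2 ^ (k i - 1)" by (rule Suc_leI, rule less_exp)
    finally show "0 \<le> k i \<and> k i \<le> 2 ^ (k i - 1)" by simp
  qed
  also have "\<dots> = 2 ^ K"
    by (simp add: K power_sum)
  finally have s_le: "s \<le> 2 ^ K" .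
  have "K > 0"
    using s(2) s_le by (cases "K = 0") auto
  have log_le: "log 2 (real s) \<le> real K"
  proof -
    have "log 2 (real s) \<le> log 2 (2 ^ K)"
      using s_le s(2) by (subst log_le_cancel_iff) (auto simp: of_nat_le_iff[symmetric] simp del: of_nat_le_iff)
    then show ?thesis by simp
  qed
  \<comment> \<open>This keeps the last denominator positive, so that shrinking K to log s enlarges
    the quotient.\<close>
  have log_ge: "1 \<le> log 2 (real s)"
    using s(2) by (simp add: le_log_iff)
  define w where "w = real s / 2 ^ K * real (K choose (K div 2))"
  have width: "int (width P R) \<le> \<lfloor>w\<rfloor>"
  proof -
    have "width P R \<le> nat \<lfloor>w\<rfloor>"
    proof (rule width_le[OF fin])
      fix S assume "antichain_on P R S"
      then have "card S * 2 ^ K \<le> s * (K choose (K div 2))"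
        using card_antichain_product_order_le_binomial[of t C r S K] chains K_card s(1)
        by (simp add: P R)
      then have "real (card S * 2 ^ K) \<le> real (s * (K choose (K div 2)))"
        by (simp only: of_nat_le_iff)
      then have "real (card S) \<le> w"
        by (simp add: w_def pos_le_divide_eq)
      then show "card S \<le> nat \<lfloor>w\<rfloor>" by (simp add: le_nat_floor)
    qed
    moreover have "0 \<le> w" by (simp add: w_def)
    ultimately show ?thesis by (simp add: le_nat_iff)
  qed
  have w_le: "\<lfloor>w\<rfloor> \<le> \<lfloor>b * real s / sqrt (real K)\<rfloor>"
  proof (rule floor_mono)
    have "real s * (real (K choose (K div 2)) / 2 ^ K) \<le> real s * (b / sqrt (real K))"
      unfolding b by (intro mult_left_mono middle_binomial_le \<open>K > 0\<close>) simp
    then show "w \<le> b * real s / sqrt (real K)"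
      by (simp add: w_def mult.commute)
  qed
  have "\<lfloor>b * real s / sqrt (real K)\<rfloor> \<le> \<lfloor>b * real s / sqrt (log 2 (real s))\<rfloor>"
    using log_le log_ge by (intro floor_mono divide_left_mono) (auto simp: b)
  moreover have "int (width P R) \<le> \<lfloor>b * real p ^ t / sqrt (real t * (real p - 1))\<rfloor>"
    if p: "\<forall>i\<in>{1..t}. k i = p" for p
  proof -
    \<comment> \<open>An index must exist to conclude p > 0; only then is the natural number p - 1
      not truncated.\<close>
    have "t > 0"
      using \<open>K > 0\<close> by (cases t) (auto simp: K)
    then have "p > 0" using k_pos[of 1] p by simp
    have "s = p ^ t" and "K = t * (p - 1)"
      using p by (simp_all add: s_prod K)
    then have "real s = real p ^ t" "real K = real t * (real p - 1)"
      using \<open>p > 0\<close> by (simp_all add: of_nat_diff)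
    then show ?thesis using width w_le by simp
  qed
  ultimately show ?thesis
    using width w_le by (simp add: w_def)
qed

end
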